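(* (Minimal support condition.) Let $\mathsf{C}$ be the convex set of block operators $A=\bigoplus_{i\in\mathsf{I}}A_i$ defined in the context. A point $A\in\mathsf{C}$ is an extreme point of $\mathsf{C}$ if and only if for every $B\in\mathsf{C}$, $$\mathrm{Supp}(B)\subseteq \mathrm{Supp}(A)\ \Longrightarrow\ A=B .$$
   Context: $\mathbf{G}$ is a compact Lie group (finite groups included) with Haar measure $dg$ normalized by $\int_{\mathbf{G}}dg=1$. $\mathcal{H}$ is a finite-dimensional complex Hilbert space and $\{U_g\mid g\in\mathbf{G}\}$ is a (generally projective) unitary representation of $\mathbf{G}$ on $\mathcal{H}$, with $g\mapsto U_gXU_g^\dagger$ continuous for every operator $X$. $\mathcal{B}(\mathcal{K})$ denotes the linear operators on $\mathcal{K}$. $\mathsf{I}$ is a finite index set, and $\mathcal{W}_i\simeq\mathcal{H}$ is a copy of $\mathcal{H}$ for each $i\in\mathsf{I}$. A block operator is an element $A=\bigoplus_{i\in\mathsf{I}}A_i$ of $\bigoplus_{i\in\mathsf{I}}\mathcal{B}(\mathcal{W}_i)$, acting on $\bigoplus_{i\in\mathsf{I}}\mathcal{W}_i$. The convex set $\mathsf{C}$ consists of all block operators $A$ with $A\ge 0$ and $$\sum_{i\in\mathsf{I}}\int_{\mathbf{G}}dg\,U_gA_iU_g^\dagger=1_{\mathcal H},$$ where $1_{\mathcal H}$ is the identity on $\mathcal{H}$. ($\mathsf{C}$ is in affine bijection with the covariant POVMs with outcome space $\mathsf{I}\times\mathbf{G}$, with operator density $M(i,g)=U_gA_iU_g^\dagger$.)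 The support $\mathrm{Supp}(X)$ of an operator $X$ is the orthogonal complement of its kernel. *)

theory Defs
  imports "HOL-Analysis.Analysis" "HOL-Algebra.Coset"
begin

text \<open>
  Points of \<open>\<real>\<^sup>n\<close> are the functions \<open>nat \<Rightarrow> real\<close> that vanish from index \<open>n\<close> on, as in
  \<^const>\<open>Euclidean_space\<close>, so that \<open>n = 0\<close> is allowed. Functions are \<open>C\<^sup>k\<close> on an open set \<open>W\<close> if
  all iterated partial derivatives up to order \<open>k\<close> exist and are continuous on \<open>W\<close>.
\<close>

primrec Ck_on :: "nat \<Rightarrow> nat \<Rightarrow> (nat \<Rightarrow> real) set \<Rightarrow> ((nat \<Rightarrow> real) \<Rightarrow> real) \<Rightarrow> bool" where
  "Ck_on n 0 W f \<longleftrightarrow> continuous_map (subtopology (Euclidean_space n) W) euclideanreal f"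
| "Ck_on n (Suc k) W f \<longleftrightarrow>
     continuous_map (subtopology (Euclidean_space n) W) euclideanreal f \<and>
     (\<exists>D. \<forall>i<n. (\<forall>x\<in>W. ((\<lambda>t. f (x(i := t))) has_real_derivative D i x) (at (x i))) \<and>
                Ck_on n k W (D i))"

definition smooth_map_on ::
    "nat \<Rightarrow> nat \<Rightarrow> (nat \<Rightarrow> real) set \<Rightarrow> ((nat \<Rightarrow> real) \<Rightarrow> (nat \<Rightarrow> real)) \<Rightarrow> bool" where
  "smooth_map_on n m W F \<longleftrightarrow> (\<forall>k. \<forall>j<m. Ck_on n k W (\<lambda>x. F x j))"

text \<open>The two components of a point of \<open>\<real>\<^sup>2\<^sup>d = \<real>\<^sup>d \<times> \<real>\<^sup>d\<close>.\<close>

definition fst_half :: "nat \<Rightarrow> (nat \<Rightarrow> real) \<Rightarrow> (nat \<Rightarrow> real)" where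
  "fst_half d z = (\<lambda>i. if i < d then z i else 0)"

definition snd_half :: "nat \<Rightarrow> (nat \<Rightarrow> real) \<Rightarrow> (nat \<Rightarrow> real)" where
  "snd_half d z = (\<lambda>i. if i < d then z (d + i) else 0)"

definition chart_on :: "'g topology \<Rightarrow> nat \<Rightarrow> 'g set \<Rightarrow> ('g \<Rightarrow> nat \<Rightarrow> real) \<Rightarrow> bool" where
  "chart_on T d V \<phi> \<longleftrightarrow>
     openin T V \<and> openin (Euclidean_space d) (\<phi> ` V) \<and>
     homeomorphic_map (subtopology T V) (subtopology (Euclidean_space d) (\<phi> ` V)) \<phi>"

definition smooth_atlas :: "'g topology \<Rightarrow> nat \<Rightarrow> ('g set \<times> ('g \<Rightarrow> nat \<Rightarrow> real)) set \<Rightarrow> bool" where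
  "smooth_atlas T d \<A> \<longleftrightarrow>
     (\<forall>(V, \<phi>)\<in>\<A>. chart_on T d V \<phi>) \<and>
     (\<Union>(V, \<phi>)\<in>\<A>. V) = topspace T \<and>
     (\<forall>(V, \<phi>)\<in>\<A>. \<forall>(W, \<psi>)\<in>\<A>.
        smooth_map_on d d (\<phi> ` (V \<inter> W)) (\<lambda>x. \<psi> (inv_into V \<phi> x)))"

text \<open>
  A Lie group on the carrier of \<open>G\<close>: a topological group with the structure of a smooth manifold
  (Hausdorff, second countable) for which multiplication and inversion are smooth in charts.
  Dimension \<open>d = 0\<close> gives the countable discrete groups, hence all finite groups.
\<close>

definition topological_group_on :: "('g, 'z) monoid_scheme \<Rightarrow> 'g topology \<Rightarrow> bool" where
  "topological_group_on G T \<longleftrightarrow>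
     group G \<and> topspace T = carrier G \<and>
     continuous_map (prod_topology T T) T (\<lambda>(g, h). g \<otimes>\<^bsub>G\<^esub> h) \<and>
     continuous_map T T (\<lambda>g. inv\<^bsub>G\<^esub> g)"

definition lie_group :: "('g, 'z) monoid_scheme \<Rightarrow> 'g topology \<Rightarrow> bool" where
  "lie_group G T \<longleftrightarrow>
     topological_group_on G T \<and> Hausdorff_space T \<and> second_countable T \<and>
     (\<exists>d \<A>. smooth_atlas T d \<A> \<and>
        (\<forall>(V1, \<phi>1)\<in>\<A>. \<forall>(V2, \<phi>2)\<in>\<A>. \<forall>(W, \<psi>)\<in>\<A>.
           smooth_map_on (d + d) d
             {z \<in> topspace (Euclidean_space (d + d)).
                fst_half d z \<in> \<phi>1 ` V1 \<and> snd_half d z \<in> \<phi>2 ` V2 \<and>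
                inv_into V1 \<phi>1 (fst_half d z) \<otimes>\<^bsub>G\<^esub> inv_into V2 \<phi>2 (snd_half d z) \<in> W}
             (\<lambda>z. \<psi> (inv_into V1 \<phi>1 (fst_half d z) \<otimes>\<^bsub>G\<^esub> inv_into V2 \<phi>2 (snd_half d z)))) \<and>
        (\<forall>(V, \<phi>)\<in>\<A>. \<forall>(W, \<psi>)\<in>\<A>.
           smooth_map_on d d (\<phi> ` {g \<in> V. inv\<^bsub>G\<^esub> g \<in> W})
             (\<lambda>x. \<psi> (inv\<^bsub>G\<^esub> (inv_into V \<phi> x)))))"

definition compact_lie_group :: "('g, 'z) monoid_scheme \<Rightarrow> 'g topology \<Rightarrow> bool" where
  "compact_lie_group G T \<longleftrightarrow> lie_group G T \<and> compact_space T"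

text \<open>
  The normalized Haar measure: the left-invariant Borel probability measure. On a compact Lie group
  it is unique, and regularity and right invariance follow.
\<close>

definition normalized_haar_measure ::
    "('g, 'z) monoid_scheme \<Rightarrow> 'g topology \<Rightarrow> 'g measure \<Rightarrow> bool" where
  "normalized_haar_measure G T \<mu> \<longleftrightarrow>
     sets \<mu> = sets (sigma (topspace T) {S. openin T S}) \<and>
     emeasure \<mu> (space \<mu>) = 1 \<and>
     (\<forall>g\<in>carrier G. \<forall>S\<in>sets \<mu>. emeasure \<mu> (g <#\<^bsub>G\<^esub> S) = emeasure \<mu> S)"

text \<open>
  The Hilbert space is \<open>complex ^ 'n\<close>, its operators are the matrices \<open>complex ^ 'n ^ 'n\<close>. The library
  inner product on \<open>complex ^ 'n\<close> is only the real part of \<open>hinner\<close>.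
\<close>

definition hinner :: "complex ^ 'n \<Rightarrow> complex ^ 'n \<Rightarrow> complex" where
  "hinner u v = (\<Sum>k\<in>UNIV. cnj (u $ k) * v $ k)"

definition dagger :: "complex ^ 'n ^ 'm \<Rightarrow> complex ^ 'm ^ 'n" where
  "dagger X = (\<chi> k l. cnj (X $ l $ k))"

definition unitary_matrix :: "complex ^ 'n ^ 'n \<Rightarrow> bool" where
  "unitary_matrix X \<longleftrightarrow> dagger X ** X = mat 1 \<and> X ** dagger X = mat 1"

definition projective_unitary_rep ::
    "('g, 'z) monoid_scheme \<Rightarrow> 'g topology \<Rightarrow> ('g \<Rightarrow> complex ^ 'n ^ 'n) \<Rightarrow> bool" where
  "projective_unitary_rep G T U \<longleftrightarrow>
     (\<forall>g\<in>carrier G. unitary_matrix (U g)) \<and>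
     (\<exists>\<omega> :: 'g \<Rightarrow> 'g \<Rightarrow> complex. \<forall>g\<in>carrier G. \<forall>h\<in>carrier G.
        norm (\<omega> g h) = 1 \<and>
        (\<forall>v. U g *v (U h *v v) = \<omega> g h *s (U (g \<otimes>\<^bsub>G\<^esub> h) *v v))) \<and>
     (\<forall>X. continuous_map T euclidean (\<lambda>g. U g ** X ** dagger (U g)))"

text \<open>
  A vector of the direct sum of the copies of \<open>complex ^ 'n\<close> indexed by \<open>'i\<close> is an element of
  \<open>complex ^ 'n ^ 'i\<close>; a block operator is the family \<open>complex ^ 'n ^ 'n ^ 'i\<close> of its blocks.
\<close>

definition sum_inner :: "complex ^ 'n ^ 'i \<Rightarrow> complex ^ 'n ^ 'i \<Rightarrow> complex" where
  "sum_inner u v = (\<Sum>i\<in>UNIV. hinner (u $ i) (v $ i))"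

definition block_apply :: "complex ^ 'n ^ 'n ^ 'i \<Rightarrow> complex ^ 'n ^ 'i \<Rightarrow> complex ^ 'n ^ 'i" where
  "block_apply A v = (\<chi> i. A $ i *v v $ i)"

definition block_nonneg :: "complex ^ 'n ^ 'n ^ 'i \<Rightarrow> bool" where
  "block_nonneg A \<longleftrightarrow> (\<forall>v. sum_inner v (block_apply A v) \<in> \<real>\<^sub>\<ge>\<^sub>0)"

definition block_kernel :: "complex ^ 'n ^ 'n ^ 'i \<Rightarrow> (complex ^ 'n ^ 'i) set" where
  "block_kernel A = {v. block_apply A v = 0}"

definition Supp :: "complex ^ 'n ^ 'n ^ 'i \<Rightarrow> (complex ^ 'n ^ 'i) set" where
  "Supp A = {u. \<forall>v\<in>block_kernel A. sum_inner v u = 0}"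

definition covariant_seeds ::
    "'g measure \<Rightarrow> ('g \<Rightarrow> complex ^ 'n ^ 'n) \<Rightarrow> (complex ^ 'n ^ 'n ^ 'i) set" where
  "covariant_seeds \<mu> U =
     {A. block_nonneg A \<and>
         (\<Sum>i\<in>UNIV. \<integral>g. U g ** (A $ i) ** dagger (U g) \<partial>\<mu>) = mat 1}"

end

(* A convex decomposition of A can only involve positive operators whose kernel contains ker A.
   Conversely, in finite dimension ker A <= ker B forces B <= c A for some c > 0, so for small
   e > 0 the operator A + e (A - B) is still positive; as the normalization is affine it lies in
   the convex set, and A lies strictly between it and B.

   Complex positivity is reduced to the real Euclidean structure: Re (sum_inner u v) is the
   library inner product, and Im (sum_inner u v) is the inner product of i u and v. *)

theory Submission
  imports Defs
begin

section \<open>Positive semidefinite maps on a Euclidean space\<close>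

text \<open>Otherwise a short step from \<open>v\<close> along \<open>- f v\<close> would make the
  quadratic form negative: the form starts at 0 and its first-order change is
  \<open>- 2 * t * (f v \<bullet> f v)\<close>.\<close>

lemma psd_quadratic_zero_imp_kernel:
  fixes f :: "'a::real_inner \<Rightarrow> 'a"
  assumes lin: "linear f" and sa: "\<And>x y. x \<bullet> f y = f x \<bullet> y"
    and pos: "\<And>x. 0 \<le> x \<bullet> f x" and zero: "v \<bullet> f v = 0"
  shows "f v = 0"
proof (rule ccontr)
  assume nz: "f v \<noteq> 0"
  define a where "a = f v \<bullet> f v"
  define b where "b = f v \<bullet> f (f v)"
  define t where "t = 1 / (b + 1)"
  have a: "a > 0" and b: "b \<ge> 0"
    using nz pos by (auto simp: a_def b_def)
  have t: "t > 0" using b by (simp add: t_def)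
  have "(v - t *\<^sub>R f v) \<bullet> f (v - t *\<^sub>R f v) = t * (t * b - 2 * a)" for t
    using zero sa[of v "f v"]
    by (simp add: linear_diff[OF lin] linear_scale[OF lin] inner_diff_left inner_diff_right
        a_def b_def inner_commute algebra_simps)
  then have "0 \<le> s * (s * b - 2 * a)" for s
    by (metis pos)
  \<comment> \<open>The step length \<open>a / (b + 1)\<close> is short enough for the first-order
    term to win; the added 1 covers \<open>b = 0\<close>.\<close>
  from this[of "a * t"] have "0 \<le> a * t * (a * (t * b - 2))"
    by (simp add: algebra_simps)
  then have "0 \<le> t * b - 2"
    using a t by (metis mult_pos_pos zero_le_mult_iff not_less)
  moreover have "t * b \<le> 1"
    using b by (simp add: t_def field_simps)
  ultimately show False by simp
qed

text \<open>Components in the kernel of \<open>f\<close> contribute to neither form. On the unit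
  sphere of its orthogonal complement the form of \<open>f\<close> is strictly positive, so the
  quotient of the two forms attains a maximum by compactness.\<close>

lemma psd_dominated_of_kernel_subset:
  fixes f g :: "'a::euclidean_space \<Rightarrow> 'a"
  assumes lin: "linear f" "linear g"
    and sa: "\<And>x y. x \<bullet> f y = f x \<bullet> y" "\<And>x y. x \<bullet> g y = g x \<bullet> y"
    and pos: "\<And>x. 0 \<le> x \<bullet> f x"
    and ker: "\<And>x. f x = 0 \<Longrightarrow> g x = 0"
  obtains c where "c > 0" "\<And>x. x \<bullet> g x \<le> c * (x \<bullet> f x)"
proof -
  define K where "K = {x. f x = 0}"
  define S where "S = {x. \<forall>y\<in>K. orthogonal y x} \<inter> sphere 0 1"
  have subK: "subspace K"
    using lin(1) by (auto simp: K_def subspace_def linear_0 linear_add linear_scale)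
  have spanK: "span K = K" using subK by (simp add: span_eq_iff)
  have contf: "continuous_on X f" and contg: "continuous_on X g" for X
    using lin by (auto intro: linear_continuous_on simp: linear_conv_bounded_linear)
  have "closed {x. \<forall>y\<in>K. orthogonal y x}"
  proof -
    have "{x. \<forall>y\<in>K. orthogonal y x} = (\<Inter>y\<in>K. {x. y \<bullet> x = 0})"
      by (auto simp: orthogonal_def)
    then show ?thesis by (auto intro!: closed_INT closed_hyperplane)
  qed
  then have compS: "compact S" by (simp add: S_def closed_Int_compact)
  have posS: "0 < x \<bullet> f x" if "x \<in> S" for x
  proof -
    have "x \<notin> K" using that by (auto simp: S_def orthogonal_def)
    then have "x \<bullet> f x \<noteq> 0"
      using psd_quadratic_zero_imp_kernel[OF lin(1) sa(1) pos] by (auto simp: K_def)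
    then show ?thesis using pos[of x] by simp
  qed
  obtain c where c: "c > 0" "\<And>x. x \<in> S \<Longrightarrow> x \<bullet> g x \<le> c * (x \<bullet> f x)"
  proof (cases "S = {}")
    \<comment> \<open>Here \<open>f\<close>, hence also \<open>g\<close>, is zero, and any positive
      constant serves.\<close>
    case True
    then show ?thesis using that[of 1] by auto
  next
    case False
    have "continuous_on S (\<lambda>x. (x \<bullet> g x) / (x \<bullet> f x))"
      by (intro continuous_intros contf contg ballI) (use posS in force)
    then obtain z where z: "\<And>x. x \<in> S \<Longrightarrow> (x \<bullet> g x) / (x \<bullet> f x) \<le> (z \<bullet> g z) / (z \<bullet> f z)"
      using continuous_attains_sup[OF compS False] by blast
    show ?thesis
    proof (rule that)
      fix x assume x: "x \<in> S"
      \<comment> \<open>The maximum with 1 keeps the constant positive; the largest quotient itself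
        may be zero or negative.\<close>
      have "(x \<bullet> g x) / (x \<bullet> f x) \<le> max 1 ((z \<bullet> g z) / (z \<bullet> f z))"
        using z[OF x] by simp
      then show "x \<bullet> g x \<le> max 1 ((z \<bullet> g z) / (z \<bullet> f z)) * (x \<bullet> f x)"
        using posS[OF x] by (simp only: pos_divide_le_eq)
    qed simp
  qed
  show ?thesis
  proof (rule that[OF c(1)])
    fix x
    obtain y w where y: "y \<in> K" and w: "\<And>u. u \<in> K \<Longrightarrow> orthogonal w u" and x: "x = y + w"
      using orthogonal_subspace_decomp_exists[of K x] spanK by metis
    have fy: "f y = 0" and gy: "g y = 0" using y ker by (auto simp: K_def)
    \<comment> \<open>The cross term vanishes by symmetry:
      \<open>y \<bullet> f w = f y \<bullet> w = 0\<close>.\<close>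
    have xf: "x \<bullet> f x = w \<bullet> f w"
      using sa(1)[of y w] fy by (simp add: x linear_add[OF lin(1)] inner_add_left)
    have xg: "x \<bullet> g x = w \<bullet> g w"
      using sa(2)[of y w] gy by (simp add: x linear_add[OF lin(2)] inner_add_left)
    show "x \<bullet> g x \<le> c * (x \<bullet> f x)"
    proof (cases "w = 0")
      case True
      then show ?thesis by (simp add: xf xg)
    next
      case False
      define s where "s = w /\<^sub>R norm w"
      have "s \<in> S"
        using w False by (auto simp: S_def s_def orthogonal_def inner_commute)
      \<comment> \<open>Both forms are homogeneous of degree two, so the bound on the sphere scales
        to \<open>w\<close>.\<close>
      moreover have "w \<bullet> h w = (norm w)\<^sup>2 * (s \<bullet> h s)" if "linear h" for h
        using False by (simp add: s_def linear_scale[OF that] power2_eq_square field_simps)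
      ultimately show ?thesis
        using mult_left_mono[OF c(2)[of s], of "(norm w)\<^sup>2"] lin
        by (simp add: xf xg mult.left_commute)
    qed
  qed
qed

section \<open>Block operators as real-linear maps\<close>

text \<open>The complex structure of the underlying real Euclidean space: a real-linear map is
  complex-linear exactly when it commutes with this one.\<close>

definition mult_i :: "complex ^ 'n ^ 'i \<Rightarrow> complex ^ 'n ^ 'i" where
  "mult_i u = (\<chi> i k. \<i> * u $ i $ k)"

lemma Re_sum_inner: "Re (sum_inner u v) = u \<bullet> v"
  by (simp add: sum_inner_def hinner_def inner_vec_def inner_complex_def)

text \<open>\<open>sum_inner\<close> is conjugate-linear in its first argument, so
  \<open>mult_i\<close> there multiplies the value by -i, and Re (-i z) = Im z.\<close>

lemma Im_sum_inner: "Im (sum_inner u v) = mult_i u \<bullet> v"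
  by (simp add: sum_inner_def hinner_def inner_vec_def inner_complex_def mult_i_def algebra_simps)

lemma sum_inner_right:
  "sum_inner u (a *\<^sub>R v + b *\<^sub>R w) = a *\<^sub>R sum_inner u v + b *\<^sub>R sum_inner u w"
  by (simp add: sum_inner_def hinner_def sum.distrib scaleR_sum_right algebra_simps)

lemma mult_i_mult_i: "mult_i (mult_i u) = - u"
  by (simp add: mult_i_def vec_eq_iff)

lemma inner_mult_i_mult_i: "mult_i u \<bullet> mult_i v = u \<bullet> v"
  by (simp add: mult_i_def inner_vec_def inner_complex_def add.commute)

lemma block_apply_mult_i: "block_apply A (mult_i v) = mult_i (block_apply A v)"
  by (simp add: block_apply_def mult_i_def vec_eq_iff matrix_vector_mult_def sum_distrib_left
      algebra_simps)

lemma linear_block_apply: "linear (block_apply A)"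
  by (rule linearI)
     (simp_all add: block_apply_def vec_eq_iff matrix_vector_mult_def sum.distrib
      scaleR_sum_right algebra_simps)

lemma block_apply_combination:
  "block_apply (a *\<^sub>R A + b *\<^sub>R B) v = a *\<^sub>R block_apply A v + b *\<^sub>R block_apply B v"
  by (simp add: block_apply_def vec_eq_iff matrix_vector_mult_def sum.distrib
      scaleR_sum_right algebra_simps)

lemma block_nonneg_inner: "block_nonneg A \<Longrightarrow> 0 \<le> v \<bullet> block_apply A v"
  by (auto simp: block_nonneg_def Re_sum_inner[symmetric] complex_nonneg_Reals_iff)

text \<open>Symmetry comes from the imaginary part of the complex quadratic form, which vanishes at
  every vector; a nonnegative real part alone would not give it.\<close>

lemma block_nonneg_selfadjoint:
  assumes "block_nonneg A"
  shows "u \<bullet> block_apply A v = block_apply A u \<bullet> v"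
proof -
  have im: "mult_i x \<bullet> block_apply A x = 0" for x
    using assms by (auto simp: block_nonneg_def Im_sum_inner[symmetric] complex_nonneg_Reals_iff)
  have add: "mult_i (x + y) = mult_i x + mult_i y" for x y :: "complex ^ 'n ^ 'i"
    by (simp add: mult_i_def vec_eq_iff algebra_simps)
  \<comment> \<open>Complex polarization, with \<open>mult_i u\<close> in the place of \<open>u\<close>.\<close>
  have "0 = mult_i (mult_i u + v) \<bullet> block_apply A (mult_i u + v)"
    by (simp only: im)
  also have "\<dots> = - (u \<bullet> block_apply A v) + mult_i v \<bullet> mult_i (block_apply A u)"
    using im[of "mult_i u"] im[of v]
    by (simp add: add linear_add[OF linear_block_apply] inner_add_left inner_add_right
        inner_diff_left mult_i_mult_i block_apply_mult_i)
  finally show ?thesis by (simp add: inner_mult_i_mult_i inner_commute)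
qed

lemma block_nonneg_quadratic_zero:
  "block_nonneg A \<Longrightarrow> v \<bullet> block_apply A v = 0 \<Longrightarrow> block_apply A v = 0"
  using psd_quadratic_zero_imp_kernel[OF linear_block_apply]
    block_nonneg_selfadjoint block_nonneg_inner by blast

lemma Supp_mono: "block_kernel A \<subseteq> block_kernel B \<Longrightarrow> Supp B \<subseteq> Supp A"
  by (auto simp: Supp_def)

text \<open>The range of a self-adjoint operator is orthogonal to its kernel. The kernel is closed
  under \<open>mult_i\<close>, which turns real orthogonality into complex orthogonality.\<close>

lemma block_apply_in_Supp:
  assumes "block_nonneg A"
  shows "block_apply A v \<in> Supp A"
proof -
  have "sum_inner w (block_apply A v) = 0" if "block_apply A w = 0" for w
  proof -
    have "block_apply A (mult_i w) = 0"
      using that by (simp add: block_apply_mult_i) (simp add: mult_i_def vec_eq_iff)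
    then show ?thesis
      using that by (simp add: complex_eq_iff Re_sum_inner Im_sum_inner
          block_nonneg_selfadjoint[OF assms])
  qed
  then show ?thesis by (auto simp: Supp_def block_kernel_def)
qed

text \<open>A converse to \<open>Supp_mono\<close> that avoids double orthogonal complements: for
  \<open>v\<close> in the kernel of \<open>A\<close>, the vector \<open>block_apply B v\<close> lies
  in \<open>Supp B\<close>, hence in \<open>Supp A\<close>, so it is orthogonal to \<open>v\<close>,
  and positivity of \<open>B\<close> makes it zero.\<close>

lemma block_kernel_mono_of_Supp:
  assumes "block_nonneg B" "Supp B \<subseteq> Supp A"
  shows "block_kernel A \<subseteq> block_kernel B"
proof
  fix v assume "v \<in> block_kernel A"
  moreover have "block_apply B v \<in> Supp A"
    using block_apply_in_Supp assms by blast
  ultimately have "sum_inner v (block_apply B v) = 0"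
    by (auto simp: Supp_def)
  then have "v \<bullet> block_apply B v = 0"
    by (simp flip: Re_sum_inner)
  then show "v \<in> block_kernel B"
    using assms(1) by (simp add: block_nonneg_quadratic_zero block_kernel_def)
qed

text \<open>On the kernel of the combination two nonnegative terms sum to zero, so each
  vanishes.\<close>

lemma block_kernel_convex_combination:
  assumes B: "block_nonneg B" and C: "block_nonneg C" and t: "0 < t" "t < 1"
  shows "block_kernel ((1 - t) *\<^sub>R B + t *\<^sub>R C) \<subseteq> block_kernel B"
proof
  fix v assume "v \<in> block_kernel ((1 - t) *\<^sub>R B + t *\<^sub>R C)"
  then have "v \<bullet> ((1 - t) *\<^sub>R block_apply B v + t *\<^sub>R block_apply C v) = 0"
    by (simp add: block_kernel_def block_apply_combination)
  then have "(1 - t) * (v \<bullet> block_apply B v) + t * (v \<bullet> block_apply C v) = 0"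
    by (simp add: inner_add_right)
  then have "(1 - t) * (v \<bullet> block_apply B v) = 0"
    using t block_nonneg_inner[OF B, of v] block_nonneg_inner[OF C, of v]
    by (smt (verit) mult_nonneg_nonneg)
  then show "v \<in> block_kernel B"
    using t B by (simp add: block_nonneg_quadratic_zero block_kernel_def)
qed

section \<open>Affinity of the normalization condition\<close>

lemma matrix_conj_combination:
  fixes V :: "complex ^ 'n ^ 'n"
  shows "V ** (a *\<^sub>R X + b *\<^sub>R Y) ** W = a *\<^sub>R (V ** X ** W) + b *\<^sub>R (V ** Y ** W)"
  by (simp add: vec_eq_iff matrix_matrix_mult_def sum.distrib scaleR_sum_right sum_distrib_right
      sum_distrib_left algebra_simps)

text \<open>A continuous function on a compact space is bounded, and the measure is finite.
  Measurability is checked on preimages of open sets, since the sigma-algebra is generated by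
  \<open>T\<close>.\<close>

lemma integrable_continuous_map:
  fixes f :: "'g \<Rightarrow> 'b::{banach, second_countable_topology}"
  assumes sets: "sets \<mu> = sets (sigma (topspace T) {S. openin T S})"
    and finite: "emeasure \<mu> (space \<mu>) \<noteq> \<infinity>"
    and comp: "compact_space T" and cont: "continuous_map T euclidean f"
  shows "integrable \<mu> f"
proof -
  have space: "space \<mu> = topspace T"
    using sets_eq_imp_space_eq[OF sets] openin_subset by (auto simp: space_measure_of_conv)
  have openin: "S \<in> sets \<mu>" if "openin T S" for S
    using that openin_subset by (subst sets, subst sets_measure_of) auto
  interpret finite_measure \<mu> by (rule finite_measureI) (use finite in simp)
  have "compactin euclidean (f ` topspace T)"
    using comp cont image_compactin unfolding compact_space_def by blast
  then obtain M where M: "\<And>x. x \<in> topspace T \<Longrightarrow> norm (f x) \<le> M"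
    by (auto dest!: compact_imp_bounded simp: bounded_iff) blast
  have "f \<in> borel_measurable \<mu>"
  proof (rule borel_measurableI)
    fix S :: "'b set" assume "open S"
    then have "openin T {x \<in> topspace T. f x \<in> S}"
      using cont by (auto simp: continuous_map_def)
    moreover have "f -` S \<inter> space \<mu> = {x \<in> topspace T. f x \<in> S}"
      by (auto simp: space)
    ultimately show "f -` S \<inter> space \<mu> \<in> sets \<mu>" using openin by simp
  qed
  then show ?thesis
    using M by (intro integrable_const_bound[of _ M]) (auto simp: space)
qed

text \<open>One coefficient may be negative, so nonnegativity is assumed separately; reality of the
  quadratic form and the normalization pass to every affine combination.\<close>

lemma covariant_seeds_affine_combination:
  fixes A B :: "complex ^ 'n ^ 'n ^ 'i"
  assumes int: "\<And>X. integrable \<mu> (\<lambda>g. U g ** X ** dagger (U g))"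
    and A: "A \<in> covariant_seeds \<mu> U" and B: "B \<in> covariant_seeds \<mu> U"
    and ab: "a + b = 1" and pos: "\<And>v. 0 \<le> v \<bullet> block_apply (a *\<^sub>R A + b *\<^sub>R B) v"
  shows "a *\<^sub>R A + b *\<^sub>R B \<in> covariant_seeds \<mu> U"
proof -
  have Im0: "Im (sum_inner v (block_apply X v)) = 0" if "X \<in> covariant_seeds \<mu> U"
    for X :: "complex ^ 'n ^ 'n ^ 'i" and v
    using that by (auto simp: covariant_seeds_def block_nonneg_def complex_nonneg_Reals_iff)
  have "Im (sum_inner v (block_apply (a *\<^sub>R A + b *\<^sub>R B) v)) = 0" for v
    by (simp add: block_apply_combination sum_inner_right Im0[OF A] Im0[OF B])
  then have "block_nonneg (a *\<^sub>R A + b *\<^sub>R B)"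
    using pos by (simp add: block_nonneg_def complex_nonneg_Reals_iff Re_sum_inner)
  moreover have "(\<Sum>i\<in>UNIV. \<integral>g. U g ** ((a *\<^sub>R A + b *\<^sub>R B) $ i) ** dagger (U g) \<partial>\<mu>)
    = a *\<^sub>R (\<Sum>i\<in>UNIV. \<integral>g. U g ** (A $ i) ** dagger (U g) \<partial>\<mu>)
      + b *\<^sub>R (\<Sum>i\<in>UNIV. \<integral>g. U g ** (B $ i) ** dagger (U g) \<partial>\<mu>)"
    by (simp add: matrix_conj_combination int sum.distrib scaleR_sum_right)
  moreover have "\<dots> = mat 1"
    using A B ab by (simp add: covariant_seeds_def flip: scaleR_add_left)
  ultimately show ?thesis by (simp add: covariant_seeds_def)
qed

section \<open>Minimal support condition\<close>

lemma extreme_of_minimal_support: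
  assumes A: "A \<in> covariant_seeds \<mu> U"
    and min: "\<And>B. B \<in> covariant_seeds \<mu> U \<Longrightarrow> Supp B \<subseteq> Supp A \<Longrightarrow> A = B"
  shows "A extreme_point_of covariant_seeds \<mu> U"
proof -
  have "A \<notin> open_segment B C"
    if B: "B \<in> covariant_seeds \<mu> U" and C: "C \<in> covariant_seeds \<mu> U" for B C
  proof
    assume "A \<in> open_segment B C"
    then obtain t where t: "0 < t" "t < 1" and eq: "A = (1 - t) *\<^sub>R B + t *\<^sub>R C" and ne: "B \<noteq> C"
      by (auto simp: in_segment)
    have "block_nonneg B" "block_nonneg C"
      using B C by (auto simp: covariant_seeds_def)
    then have "Supp B \<subseteq> Supp A"
      unfolding eq by (intro Supp_mono block_kernel_convex_combination t)
    \<comment> \<open>One endpoint suffices: if \<open>B\<close> equals the interior point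
      \<open>A\<close>, the segment degenerates.\<close>
    then have "A = B" using min B by blast
    with eq have "B = (1 - t) *\<^sub>R B + t *\<^sub>R C" by simp
    then have "t *\<^sub>R B = t *\<^sub>R C" by (auto simp: scaleR_diff_left)
    with t ne show False by auto
  qed
  with A show ?thesis by (auto simp: extreme_point_of_def)
qed

lemma minimal_support_of_extreme:
  assumes int: "\<And>X. integrable \<mu> (\<lambda>g. U g ** X ** dagger (U g))"
    and ext: "A extreme_point_of covariant_seeds \<mu> U"
    and B: "B \<in> covariant_seeds \<mu> U" and supp: "Supp B \<subseteq> Supp A"
  shows "A = B"
proof (rule ccontr)
  assume ne: "A \<noteq> B"
  have A: "A \<in> covariant_seeds \<mu> U" using ext by (simp add: extreme_point_of_def)
  have nA: "block_nonneg A" and nB: "block_nonneg B"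
    using A B by (auto simp: covariant_seeds_def)
  have "block_kernel A \<subseteq> block_kernel B"
    using block_kernel_mono_of_Supp nB supp .
  then obtain c where c: "c > 0" and le: "\<And>v. v \<bullet> block_apply B v \<le> c * (v \<bullet> block_apply A v)"
    using psd_dominated_of_kernel_subset[OF linear_block_apply[of A] linear_block_apply[of B]
        block_nonneg_selfadjoint[OF nA] block_nonneg_selfadjoint[OF nB] block_nonneg_inner[OF nA]]
    unfolding block_kernel_def by blast
  \<comment> \<open>This is \<open>A + (1 / c) *\<^sub>R (A - B)\<close>, beyond \<open>A\<close> on
    the ray from \<open>B\<close>. Its form is that of \<open>A\<close> divided by \<open>c\<close>,
    plus that of \<open>A - B / c\<close>, and both are nonnegative.\<close>
  define C where "C = (1 + 1 / c) *\<^sub>R A + (- 1 / c) *\<^sub>R B"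
  have "C \<in> covariant_seeds \<mu> U"
    unfolding C_def
  proof (rule covariant_seeds_affine_combination[OF int A B])
    fix v
    have "(v \<bullet> block_apply B v) / c \<le> v \<bullet> block_apply A v"
      using le[of v] c by (simp add: field_simps)
    moreover have "0 \<le> (v \<bullet> block_apply A v) / c"
      using block_nonneg_inner[OF nA, of v] c by simp
    ultimately show "0 \<le> v \<bullet> block_apply ((1 + 1 / c) *\<^sub>R A + (- 1 / c) *\<^sub>R B) v"
      unfolding block_apply_combination by (simp add: inner_diff_right algebra_simps)
  qed simp
  moreover have "A \<in> open_segment C B"
  proof -
    \<comment> \<open>Chosen so that \<open>(1 - t) * (1 + 1 / c) = 1\<close>; the coefficient of
      \<open>B\<close> then cancels.\<close>
    define t where "t = 1 / (c + 1)"
    have t: "0 < t" "t < 1" using c by (auto simp: t_def)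
    have nz: "c \<noteq> 0" "c + 1 \<noteq> 0" using c by auto
    then have "1 - t = c / (c + 1)" by (simp add: t_def field_simps)
    then have "(1 - t) * (1 + 1 / c) = 1" "(1 - t) * (- 1 / c) + t = 0"
      using nz by (auto simp: t_def divide_simps)
    then have "A = ((1 - t) * (1 + 1 / c)) *\<^sub>R A + ((1 - t) * (- 1 / c) + t) *\<^sub>R B"
      by simp
    also have "\<dots> = (1 - t) *\<^sub>R C + t *\<^sub>R B"
      by (simp only: C_def scaleR_add_right scaleR_scaleR add.assoc
          scaleR_add_left[of "(1 - t) * (- 1 / c)"])
    finally have eq: "A = (1 - t) *\<^sub>R C + t *\<^sub>R B" .
    moreover have "C \<noteq> B"
      using eq ne by (auto simp flip: scaleR_add_left)
    ultimately show ?thesis using t by (auto simp: in_segment)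
  qed
  ultimately show False
    using ext B by (auto simp: extreme_point_of_def)
qed

theorem theorem1:
  fixes G :: "('g, 'z) monoid_scheme"
    and T :: "'g topology"
    and \<mu> :: "'g measure"
    and U :: "'g \<Rightarrow> complex ^ 'n ^ 'n"
    and A :: "complex ^ 'n ^ 'n ^ 'i"
  assumes "compact_lie_group G T"
    and "normalized_haar_measure G T \<mu>"
    and "projective_unitary_rep G T U"
    and "A \<in> covariant_seeds \<mu> U"
  shows "A extreme_point_of covariant_seeds \<mu> U \<longleftrightarrow>
    (\<forall>B \<in> covariant_seeds \<mu> U. Supp B \<subseteq> Supp A \<longrightarrow> A = B)"
proof -
  \<comment> \<open>The Bochner integral of a non-integrable function is 0 by convention, so
    integrability is what makes the normalization linear in the block operator.\<close>
  have int: "integrable \<mu> (\<lambda>g. U g ** X ** dagger (U g))" for X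
    using assms(1-3)
    by (intro integrable_continuous_map[of \<mu> T])
       (auto simp: compact_lie_group_def normalized_haar_measure_def projective_unitary_rep_def)
  show ?thesis
    using extreme_of_minimal_support[OF assms(4)] minimal_support_of_extreme[OF int] by blast
qed

end
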